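(* Every consistent linear multistep method is globally conservative: let $\hat{\mathbf f}:\mathbb R^m\to\mathbb R^m$ be a globally conservative discretization with cell volumes $|\Omega_1|,\dots,|\Omega_m|$, and let $(\mathbf u^n)_{n\ge0}$ be a sequence in $\mathbb R^m$ satisfying, for all $n\ge 0$, $$\sum_{j=0}^s a_j\mathbf u^{n+j}=\Delta t\sum_{j=0}^s b_j\hat{\mathbf f}(\mathbf u^{n+j}),$$ where the coefficients satisfy $a_s=1$ and $a_0+\dots+a_{s-1}=-1$. If the starting values satisfy $\sum_{i=1}^m|\Omega_i|u_i^{j}=\sum_{i=1}^m|\Omega_i|u_i^0$ for $j=0,\dots,s-1$, then $$\sum_{i=1}^m|\Omega_i|u_i^{n+1}=\sum_{i=1}^m|\Omega_i|u_i^n\qquad\text{for all } n=0,1,\dots$$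
   Context: $\hat{\mathbf f}=(\hat f_1,\dots,\hat f_m)^\top$ is the right-hand side of a semidiscretization $\mathbf u_t=\hat{\mathbf f}(\mathbf u)$ on a mesh with cells $\Omega_i$ of volume $|\Omega_i|>0$. It is called globally conservative if $\sum_{i=1}^m|\Omega_i|\hat f_i(\mathbf u)=0$ for all $\mathbf u\in\mathbb R^m$. A time integration method is globally conservative if $\sum_i|\Omega_i|u_i^{n+1}=\sum_i|\Omega_i|u_i^n$ in every time step. Here $s\ge1$, $a_j,b_j\in\mathbb R$ and $\Delta t>0$. *)

theory Defs
  imports "HOL-Analysis.Analysis"
begin

text \<open>The cells are indexed by a finite type \<open>'m\<close>, and \<open>vol i\<close> is the volume of cell \<open>i\<close>.\<close>

definition total_amount :: "('m::finite \<Rightarrow> real) \<Rightarrow> real ^ 'm \<Rightarrow> real" where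
  "total_amount vol u = (\<Sum>i\<in>UNIV. vol i * u $ i)"

definition globally_conservative_discretization ::
    "('m::finite \<Rightarrow> real) \<Rightarrow> (real ^ 'm \<Rightarrow> real ^ 'm) \<Rightarrow> bool" where
  "globally_conservative_discretization vol f \<longleftrightarrow>
     (\<forall>u. (\<Sum>i\<in>UNIV. vol i * f u $ i) = 0)"

text \<open>The method may be implicit (\<open>b s \<noteq> 0\<close>), so a numerical solution is a sequence satisfying
  the recurrence, not one computed from its starting values.\<close>

definition linear_multistep_solution ::
    "nat \<Rightarrow> (nat \<Rightarrow> real) \<Rightarrow> (nat \<Rightarrow> real) \<Rightarrow> real \<Rightarrow> (real ^ 'm \<Rightarrow> real ^ 'm)
      \<Rightarrow> (nat \<Rightarrow> real ^ 'm) \<Rightarrow> bool" where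
  "linear_multistep_solution s a b \<Delta>t f u \<longleftrightarrow>
     (\<forall>n. (\<Sum>j=0..s. a j *\<^sub>R u (n + j)) = \<Delta>t *\<^sub>R (\<Sum>j=0..s. b j *\<^sub>R f (u (n + j))))"

end

theory Submission
  imports Defs
begin

text \<open>The total amount is a linear functional that vanishes on the range of a globally conservative
  right-hand side.  Applying it to the multistep recurrence therefore removes the terms in \<open>f\<close>, so
  the totals satisfy the scalar homogeneous recurrence with coefficients \<open>a 0, \<dots>, a s\<close>
  (\<open>total_amount_recurrence\<close>).  Consistency says that \<open>a 0 + \<dots> + a s = 0\<close> with \<open>a s = 1\<close>: every new
  total is an affine combination, with weights \<open>- a j\<close> of sum one, of the preceding \<open>s\<close> totals.
  Hence equal starting totals propagate to all later ones (\<open>recurrence_preserves_constant\<close>).\<close>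

lemma linear_total_amount: "linear (total_amount vol)"
  by (rule linearI)
    (simp_all add: total_amount_def algebra_simps sum.distrib sum_distrib_left)

text \<open>The right-hand side need not be evaluated at known states, so implicit methods are covered.\<close>

lemma total_amount_recurrence:
  assumes "globally_conservative_discretization vol f"
    and "linear_multistep_solution s a b \<Delta>t f u"
  shows "(\<Sum>j=0..s. a j * total_amount vol (u (n + j))) = 0"
proof -
  interpret linear "total_amount vol" by (rule linear_total_amount)
  have vanish: "total_amount vol (f v) = 0" for v
    using assms(1) by (simp add: globally_conservative_discretization_def total_amount_def)
  have "(\<Sum>j=0..s. a j * total_amount vol (u (n + j)))
      = total_amount vol (\<Sum>j=0..s. a j *\<^sub>R u (n + j))"
    by (simp add: sum scale)
  also have "\<dots> = total_amount vol (\<Delta>t *\<^sub>R (\<Sum>j=0..s. b j *\<^sub>R f (u (n + j))))"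
    using assms(2) by (simp add: linear_multistep_solution_def)
  also have "\<dots> = 0"
    by (simp add: sum scale vanish)
  finally show ?thesis .
qed

text \<open>Constant sequences solve the recurrence because its coefficients sum to zero, and the leading
  coefficient one makes the solution with given starting values unique.\<close>

lemma recurrence_preserves_constant:
  fixes U :: "nat \<Rightarrow> 'a::comm_ring_1"
  assumes lead: "a s = 1"
    and consistent: "(\<Sum>j<s. a j) = - 1"
    and rec: "\<And>n. (\<Sum>j=0..s. a j * U (n + j)) = 0"
    and start: "\<And>j. j < s \<Longrightarrow> U j = c"
  shows "U n = c"
proof (induction n rule: less_induct)
  case (less n)
  show ?case
  proof (cases "n < s")
    case True
    then show ?thesis by (rule start)
  next
    case False
    then obtain k where n: "n = k + s"
      by (metis add.commute le_Suc_ex not_less)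
    have "(\<Sum>j<s. a j * U (k + j)) = (\<Sum>j<s. a j * c)"
      by (rule sum.cong) (simp_all add: less n)
    also have "\<dots> = - c"
      by (simp add: consistent flip: sum_distrib_right)
    finally have "U n - c = (\<Sum>j=0..s. a j * U (k + j))"
      by (simp add: n lead atLeast0AtMost flip: lessThan_Suc_atMost)
    then show ?thesis by (simp add: rec)
  qed
qed

theorem mainTheorem3:
  fixes vol :: "'m::finite \<Rightarrow> real"
    and f :: "real ^ 'm \<Rightarrow> real ^ 'm"
    and s :: nat
    and a b :: "nat \<Rightarrow> real"
    and \<Delta>t :: real
    and u :: "nat \<Rightarrow> real ^ 'm"
  assumes "\<And>i. vol i > 0"
    and "globally_conservative_discretization vol f"
    and "s \<ge> 1"
    and "\<Delta>t > 0"
    and "a s = 1"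
    and "(\<Sum>j<s. a j) = -1"
    and "linear_multistep_solution s a b \<Delta>t f u"
    and "\<And>j. j < s \<Longrightarrow> total_amount vol (u j) = total_amount vol (u 0)"
  shows "\<forall>n. total_amount vol (u (n + 1)) = total_amount vol (u n)"
proof -
  have "total_amount vol (u n) = total_amount vol (u 0)" for n
    using assms(5,6) total_amount_recurrence[OF assms(2,7)] assms(8)
    by (rule recurrence_preserves_constant)
  then show ?thesis by metis
qed

end
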